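(* Let $G$ and $H$ be two finite bipartite graphs. Then $mp_f(G\square H)\geqslant mp_f(G)+\lfloor mp_f(H)\rfloor$, and equality holds when both $G$ and $H$ are regular.
   Context: The Cartesian product $G\square H$ has vertex set $V(G)\times V(H)$, with $(g,h)$ and $(g',h')$ adjacent iff either $g=g'$ and $hh'\in E(H)$, or $gg'\in E(G)$ and $h=h'$. For a graph $\Gamma$, let $\mathcal{M}(\Gamma)$ be its set of perfect matchings and $\bm{q}^M\in\mathbb{R}^{E(\Gamma)}$ the incidence vector of $M$; the fractional matching preclusion number $mp_f(\Gamma)$ is the optimal value of the linear program: minimize $\bm{1}^T\bm{y}$ over $\bm{y}\in\mathbb{R}^{E(\Gamma)}$ subject to $(\bm{q}^M)^T\bm{y}\geqslant 1$ for every $M\in\mathcal{M}(\Gamma)$ and $\bm{y}\geqslant 0$. *)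

theory Defs
  imports Complex_Main "HOL-Library.Indicator_Function"
begin

record 'a ugraph =
  verts :: "'a set"
  edges :: "'a set set"

definition finite_simple_graph :: "'a ugraph \<Rightarrow> bool" where
  "finite_simple_graph G \<longleftrightarrow> finite (verts G) \<and>
     (\<forall>e \<in> edges G. \<exists>u \<in> verts G. \<exists>v \<in> verts G. u \<noteq> v \<and> e = {u, v})"

definition bipartite :: "'a ugraph \<Rightarrow> bool" where
  "bipartite G \<longleftrightarrow> (\<exists>A B. A \<union> B = verts G \<and> A \<inter> B = {} \<and>
     (\<forall>e \<in> edges G. \<exists>a \<in> A. \<exists>b \<in> B. e = {a, b}))"

definition degree :: "'a ugraph \<Rightarrow> 'a \<Rightarrow> nat" where
  "degree G v = card {e \<in> edges G. v \<in> e}"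

definition regular :: "'a ugraph \<Rightarrow> bool" where
  "regular G \<longleftrightarrow> (\<exists>k. \<forall>v \<in> verts G. degree G v = k)"

definition cartesian_product :: "'a ugraph \<Rightarrow> 'b ugraph \<Rightarrow> ('a \<times> 'b) ugraph"
    (infixl "\<box>" 70) where
  "G \<box> H = \<lparr>
     verts = verts G \<times> verts H,
     edges = {{(g, h), (g', h')} | g h g' h'.
       g \<in> verts G \<and> g' \<in> verts G \<and> h \<in> verts H \<and> h' \<in> verts H \<and>
       (g = g' \<and> {h, h'} \<in> edges H \<or> {g, g'} \<in> edges G \<and> h = h')}\<rparr>"

definition matching :: "'a ugraph \<Rightarrow> 'a set set \<Rightarrow> bool" where
  "matching G M \<longleftrightarrow> M \<subseteq> edges G \<and> (\<forall>e \<in> M. \<forall>f \<in> M. e \<noteq> f \<longrightarrow> e \<inter> f = {})"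

definition perfect_matchings :: "'a ugraph \<Rightarrow> 'a set set set" where
  "perfect_matchings G = {M. matching G M \<and> \<Union>M = verts G}"

text \<open>Vectors in \<open>\<real>\<^sup>E\<close> are functions on sets of vertices of which only the values on
  the edge set are relevant; the incidence vector of \<open>M\<close> is \<^term>\<open>indicator M\<close>.\<close>

definition mp_feasible :: "'a ugraph \<Rightarrow> ('a set \<Rightarrow> real) \<Rightarrow> bool" where
  "mp_feasible G y \<longleftrightarrow>
     (\<forall>M \<in> perfect_matchings G. (\<Sum>e \<in> edges G. indicator M e * y e) \<ge> 1) \<and>
     (\<forall>e \<in> edges G. y e \<ge> 0)"

text \<open>For a finite simple graph with at least one vertex the program is feasible (take
  \<open>y = 1\<close>) and its objective is bounded below by 0, so this infimum is the optimal value. For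
  the graph without vertices the empty matching is perfect, the program is infeasible, and
  the value below is meaningless.\<close>

definition mp_f :: "'a ugraph \<Rightarrow> real" where
  "mp_f G = Inf {(\<Sum>e \<in> edges G. y e) | y. mp_feasible G y}"

end

theory Submission
  imports Defs
begin

text \<open>A feasible vector \<open>y\<close> for \<open>G \<box> H\<close> splits over the two kinds of edges: summing it over
  the parallel copies of an edge of \<open>G\<close> gives a vector feasible for \<open>G\<close>, because the copies of
  a perfect matching \<open>M\<close> of \<open>G\<close> in all fibres together form a perfect matching of \<open>G \<box> H\<close>;
  likewise for \<open>H\<close>. Hence even \<open>mp_f (G \<box> H) \<ge> mp_f G + mp_f H\<close>, and the floor can only
  decrease the right-hand side. The star of a vertex meets every perfect matching, so
  \<open>mp_f\<close> is at most any degree; and a \<open>k\<close>-regular bipartite graph splits into \<open>k\<close> perfect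
  matchings by Hall's theorem, so there \<open>mp_f\<close> equals the degree, which gives equality.\<close>

section \<open>Hall's theorem and regular bipartite graphs\<close>

text \<open>Induction on the size of the index set. If some nonempty proper \<open>J\<close> is
  tight, \<open>J\<close> is matched first and the remaining indices use only values outside its
  neighbourhood. Otherwise every nonempty proper subfamily has a spare value, so one index can take
  any value it likes.\<close>

theorem Hall_marriage:
  fixes N :: "'i \<Rightarrow> 'b set"
  assumes "finite I" and "\<And>i. i \<in> I \<Longrightarrow> finite (N i)"
    and "\<And>J. J \<subseteq> I \<Longrightarrow> card J \<le> card (\<Union>(N ` J))"
  shows "\<exists>f. inj_on f I \<and> (\<forall>i\<in>I. f i \<in> N i)"
  using assms
proof (induction "card I" arbitrary: I N rule: less_induct)
  case less
  note fin = less.prems(1) and finN = less.prems(2) and hall = less.prems(3)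
  have finU: "finite (\<Union>(N ` J))" if "J \<subseteq> I" for J
    using that fin finN by (auto intro: finite_subset)
  show ?case
  proof (cases "I = {}")
    case False
    then obtain i where i: "i \<in> I" by blast
    show ?thesis
    proof (cases "\<exists>J. J \<subset> I \<and> J \<noteq> {} \<and> card (\<Union>(N ` J)) = card J")
      case True
      then obtain J where J: "J \<subset> I" "J \<noteq> {}" "card (\<Union>(N ` J)) = card J" by blast
      have finJ: "finite J" using J(1) fin by (meson finite_subset psubset_imp_subset)
      have "\<exists>f. inj_on f J \<and> (\<forall>i\<in>J. f i \<in> N i)"
        by (rule less.hyps) (use J fin finJ finN hall in \<open>auto intro: psubset_card_mono\<close>)
      then obtain f where f: "inj_on f J" "\<forall>i\<in>J. f i \<in> N i" by blast
      let ?N = "\<lambda>i. N i - \<Union>(N ` J)"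
      have "\<exists>g. inj_on g (I - J) \<and> (\<forall>i\<in>I - J. g i \<in> ?N i)"
      proof (rule less.hyps)
        show "card (I - J) < card I"
          using J fin by (intro psubset_card_mono) auto
        fix K assume K: "K \<subseteq> I - J"
        have finK: "finite K" using K fin by (meson finite_Diff finite_subset)
        \<comment> \<open>Hall's condition for the reduced family: apply the original one to
          \<open>K \<union> J\<close> and subtract the tight equality for \<open>J\<close>.\<close>
        have "card K + card J = card (K \<union> J)"
          using K finK finJ by (subst card_Un_disjoint) auto
        also have "\<dots> \<le> card (\<Union>(N ` (K \<union> J)))"
          using K J by (intro hall) auto
        also have "\<Union>(N ` (K \<union> J)) = \<Union>(?N ` K) \<union> \<Union>(N ` J)" by auto
        also have "card \<dots> = card (\<Union>(?N ` K)) + card (\<Union>(N ` J))"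
          using finU[of K] finU[of J] K J
          by (intro card_Un_disjoint) (auto intro: finite_subset[of _ "\<Union>(N ` K)"])
        finally show "card K \<le> card (\<Union>(?N ` K))" using J(3) by simp
      qed (use fin finN in auto)
      then obtain g where g: "inj_on g (I - J)" "\<forall>i\<in>I - J. g i \<in> ?N i" by blast
      let ?h = "\<lambda>i. if i \<in> J then f i else g i"
      have "inj_on ?h I"
      proof (rule inj_onI)
        fix a b assume ab: "a \<in> I" "b \<in> I" "?h a = ?h b"
        show "a = b"
        proof (cases "a \<in> J"; cases "b \<in> J")
          assume "a \<in> J" "b \<in> J" then show ?thesis using ab f(1) by (auto dest: inj_onD)
        next
          assume "a \<notin> J" "b \<notin> J" then show ?thesis using ab g(1) by (auto dest: inj_onD)
        next
          \<comment> \<open>The mixed cases cannot occur: \<open>f\<close> takes values in the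
            neighbourhood of \<open>J\<close>, and \<open>g\<close> avoids it.\<close>
          assume "a \<in> J" "b \<notin> J"
          moreover from this have "f a \<in> N a" "g b \<notin> N a" using ab(1,2) f(2) g(2) by auto
          ultimately show ?thesis using ab(3) by simp
        next
          assume "a \<notin> J" "b \<in> J"
          moreover from this have "f b \<in> N b" "g a \<notin> N b" using ab(1,2) f(2) g(2) by auto
          ultimately show ?thesis using ab(3) by simp
        qed
      qed
      moreover have "\<forall>i\<in>I. ?h i \<in> N i" using f(2) g(2) by auto
      ultimately show ?thesis by (intro exI[of _ ?h] conjI)
    next
      case no_tight: False
      have "card {i} \<le> card (\<Union>(N ` {i}))" using i by (intro hall) auto
      then obtain x where x: "x \<in> N i" by fastforce
      let ?N = "\<lambda>j. N j - {x}"
      have "\<exists>g. inj_on g (I - {i}) \<and> (\<forall>j\<in>I - {i}. g j \<in> ?N j)"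
      proof (rule less.hyps)
        show "card (I - {i}) < card I" using i fin by (intro psubset_card_mono) auto
        fix K assume K: "K \<subseteq> I - {i}"
        show "card K \<le> card (\<Union>(?N ` K))"
        proof (cases "K = {}")
          case False
          have "K \<subset> I" using K i by auto
          \<comment> \<open>Since \<open>K\<close> is not tight, its neighbourhood has at least one
            value to spare, which pays for the removal of \<open>x\<close>.\<close>
          then have "card (\<Union>(N ` K)) \<noteq> card K" using no_tight False by metis
          moreover have "card K \<le> card (\<Union>(N ` K))" using K by (intro hall) auto
          moreover have "\<Union>(?N ` K) = \<Union>(N ` K) - {x}" by auto
          ultimately show ?thesis by (auto simp: card_Diff_singleton_if)
        qed simp
      qed (use fin finN in auto)
      then obtain g where g: "inj_on g (I - {i})" "\<forall>j\<in>I - {i}. g j \<in> ?N j" by blast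
      have "inj_on (g(i := x)) I"
        using g by (auto simp: inj_on_def)
      moreover have "\<forall>j\<in>I. (g(i := x)) j \<in> N j" using g(2) x by auto
      ultimately show ?thesis by blast
    qed
  qed auto
qed

lemma finite_edges:
  assumes "finite_simple_graph G" shows "finite (edges G)"
proof (rule finite_subset)
  show "edges G \<subseteq> Pow (verts G)" using assms by (auto simp: finite_simple_graph_def)
  show "finite (Pow (verts G))" using assms by (simp add: finite_simple_graph_def)
qed

text \<open>By independence no edge lies in the stars of two vertices of \<open>J\<close>, so the
  stars are disjoint and their sizes add up. It is applied to subsets of one colour class.\<close>

lemma card_edges_meeting:
  assumes "finite (edges G)" and "finite J"
    and indep: "\<And>e u v. \<lbrakk>e \<in> edges G; u \<in> J; v \<in> J; u \<in> e; v \<in> e\<rbrakk> \<Longrightarrow> u = v"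
    and deg: "\<And>v. v \<in> J \<Longrightarrow> degree G v = k"
  shows "card {e \<in> edges G. e \<inter> J \<noteq> {}} = k * card J"
proof -
  have "{e \<in> edges G. e \<inter> J \<noteq> {}} = (\<Union>v\<in>J. {e \<in> edges G. v \<in> e})" by auto
  also have "card \<dots> = (\<Sum>v\<in>J. card {e \<in> edges G. v \<in> e})"
    using assms by (intro card_UN_disjoint) auto
  also have "\<dots> = k * card J" using deg by (simp add: degree_def)
  finally show ?thesis .
qed

text \<open>Double counting gives Hall's condition: the \<open>k * card J\<close> edges at
  \<open>J\<close> all end in the neighbourhood of \<open>J\<close>, which meets only
  \<open>k\<close> times its size many edges. Cancelling \<open>k > 0\<close> finishes the
  count.\<close>

lemma regular_bipartite_perfect_matching:
  assumes fsg: "finite_simple_graph G" and "bipartite G"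
    and deg: "\<And>v. v \<in> verts G \<Longrightarrow> degree G v = k" and k: "k > 0"
  shows "perfect_matchings G \<noteq> {}"
proof -
  obtain A B where AB: "A \<union> B = verts G" "A \<inter> B = {}"
    and E: "\<And>e. e \<in> edges G \<Longrightarrow> \<exists>a\<in>A. \<exists>b\<in>B. e = {a, b}"
    using \<open>bipartite G\<close> by (auto simp: bipartite_def)
  have finE: "finite (edges G)" using fsg by (rule finite_edges)
  have finAB: "finite A" "finite B"
    using fsg AB(1) by (auto simp: finite_simple_graph_def dest: finite_subset[rotated])
  have cardA: "card {e \<in> edges G. e \<inter> J \<noteq> {}} = k * card J" if "J \<subseteq> A" for J
  proof (rule card_edges_meeting[OF finE])
    show "finite J" using that finAB by (auto intro: finite_subset)
    show "u = v" if "e \<in> edges G" "u \<in> J" "v \<in> J" "u \<in> e" "v \<in> e" for e u v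
      using E[OF that(1)] that \<open>J \<subseteq> A\<close> AB(2) by blast
  qed (use deg AB that in auto)
  have cardB: "card {e \<in> edges G. e \<inter> J \<noteq> {}} = k * card J" if "J \<subseteq> B" for J
  proof (rule card_edges_meeting[OF finE])
    show "finite J" using that finAB by (auto intro: finite_subset)
    show "u = v" if "e \<in> edges G" "u \<in> J" "v \<in> J" "u \<in> e" "v \<in> e" for e u v
      using E[OF that(1)] that \<open>J \<subseteq> B\<close> AB(2) by blast
  qed (use deg AB that in auto)
  \<comment> \<open>Both sets are the whole edge set, so the two classes have equal size; this later
    makes the injection \<open>f\<close> onto \<open>B\<close>.\<close>
  have "{e \<in> edges G. e \<inter> A \<noteq> {}} = {e \<in> edges G. e \<inter> B \<noteq> {}}" using E by blast
  then have card_eq: "card A = card B" using cardA[of A] cardB[of B] k by simp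
  let ?N = "\<lambda>a. {b \<in> B. {a, b} \<in> edges G}"
  have "\<exists>f. inj_on f A \<and> (\<forall>a\<in>A. f a \<in> ?N a)"
  proof (rule Hall_marriage)
    fix J assume J: "J \<subseteq> A"
    let ?NJ = "\<Union>(?N ` J)"
    have NJ: "?NJ \<subseteq> B" by auto
    have "{e \<in> edges G. e \<inter> J \<noteq> {}} \<subseteq> {e \<in> edges G. e \<inter> ?NJ \<noteq> {}}"
    proof
      fix e assume "e \<in> {e \<in> edges G. e \<inter> J \<noteq> {}}"
      then have e: "e \<in> edges G" "e \<inter> J \<noteq> {}" by auto
      from E[OF e(1)] obtain a b where ab: "a \<in> A" "b \<in> B" "e = {a, b}" by blast
      then have "a \<in> J" using e(2) J AB(2) by blast
      then have "b \<in> ?NJ" using ab e(1) by blast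
      then show "e \<in> {e \<in> edges G. e \<inter> ?NJ \<noteq> {}}" using ab e(1) by blast
    qed
    then have "card {e \<in> edges G. e \<inter> J \<noteq> {}} \<le> card {e \<in> edges G. e \<inter> ?NJ \<noteq> {}}"
      using finE by (intro card_mono) auto
    then have "k * card J \<le> k * card ?NJ" using cardA[OF J] cardB[OF NJ] by simp
    then show "card J \<le> card ?NJ" using k by simp
  qed (use finAB in auto)
  then obtain f where f: "inj_on f A" "\<And>a. a \<in> A \<Longrightarrow> f a \<in> B" "\<And>a. a \<in> A \<Longrightarrow> {a, f a} \<in> edges G"
    by blast
  have surj: "f ` A = B"
    using f finAB card_eq by (intro card_subset_eq) (auto simp: card_image)
  let ?M = "(\<lambda>a. {a, f a}) ` A"
  have "matching G ?M"
    unfolding matching_def using f AB(2) by (auto dest: inj_onD)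
  moreover have "\<Union>?M = verts G" using surj AB(1) by auto
  ultimately show ?thesis by (auto simp: perfect_matchings_def)
qed

section \<open>Bounds on the fractional matching preclusion number\<close>

text \<open>A perfect matching consists of edges, so the indicator merely restricts the sum to
  \<open>M\<close>. All later arguments use this form of the constraints.\<close>

lemma mp_feasible_iff:
  assumes "finite (edges G)"
  shows "mp_feasible G y \<longleftrightarrow>
    (\<forall>M\<in>perfect_matchings G. sum y M \<ge> 1) \<and> (\<forall>e\<in>edges G. y e \<ge> 0)"
proof -
  have "(\<Sum>e\<in>edges G. indicator M e * y e) = sum y M" if "M \<in> perfect_matchings G" for M
  proof -
    have "M \<subseteq> edges G" using that by (simp add: perfect_matchings_def matching_def)
    then show ?thesis
      using assms by (intro sum.mono_neutral_cong_right) (auto simp: indicator_def)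
  qed
  then show ?thesis by (simp add: mp_feasible_def)
qed

lemma mp_f_le_sum:
  assumes "mp_feasible G y" shows "mp_f G \<le> sum y (edges G)"
  unfolding mp_f_def
proof (rule cInf_lower)
  show "bdd_below {sum y (edges G) | y. mp_feasible G y}"
    by (rule bdd_belowI[of _ 0]) (auto simp: mp_feasible_def intro: sum_nonneg)
qed (use assms in auto)

text \<open>A perfect matching covers \<open>v\<close>, hence contains an edge of weight 1. Besides
  the degree bound, this vector witnesses that the linear program is feasible.\<close>

lemma mp_feasible_star:
  assumes "finite (edges G)" and v: "v \<in> verts G"
  shows "mp_feasible G (\<lambda>e. of_bool (v \<in> e))"
  unfolding mp_feasible_iff[OF assms(1)]
proof (intro conjI ballI)
  fix M assume M: "M \<in> perfect_matchings G"
  then have "finite M" using assms(1) by (auto simp: perfect_matchings_def matching_def intro: finite_subset)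
  moreover from M v obtain e where "e \<in> M" "v \<in> e"
    by (auto simp: perfect_matchings_def)
  ultimately show "1 \<le> (\<Sum>e\<in>M. of_bool (v \<in> e) :: real)"
    using member_le_sum[of e M "\<lambda>e. of_bool (v \<in> e) :: real"] by simp
qed simp

lemma mp_f_le_degree:
  assumes "finite (edges G)" and "v \<in> verts G"
  shows "mp_f G \<le> degree G v"
proof -
  have "mp_f G \<le> (\<Sum>e\<in>edges G. of_bool (v \<in> e))"
    by (rule mp_f_le_sum[OF mp_feasible_star[OF assms]])
  also have "\<dots> = degree G v"
    using assms(1) by (simp add: degree_def sum.If_cases of_bool_def Int_def)
  finally show ?thesis .
qed

text \<open>On the reals \<open>Inf\<close> is meaningful only for nonempty sets bounded below; a
  vertex supplies nonemptiness through its star vector.\<close>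

lemma mp_f_greatest:
  assumes "finite (edges G)" and "verts G \<noteq> {}"
    and "\<And>y. mp_feasible G y \<Longrightarrow> c \<le> sum y (edges G)"
  shows "c \<le> mp_f G"
  unfolding mp_f_def
proof (rule cInf_greatest)
  obtain v where "v \<in> verts G" using assms(2) by blast
  from mp_feasible_star[OF assms(1) this]
  show "{sum y (edges G) | y. mp_feasible G y} \<noteq> {}"
    by auto
qed (use assms(3) in auto)

text \<open>Induction on the degree: a perfect matching carries weight at least 1 under
  \<open>y\<close>, and deleting it leaves a bipartite graph of degree one less on the same
  vertices.\<close>

lemma regular_bipartite_sum_ge:
  assumes "finite_simple_graph G" and "bipartite G"
    and "\<And>v. v \<in> verts G \<Longrightarrow> degree G v = k" and "mp_feasible G y"
  shows "real k \<le> sum y (edges G)"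
  using assms
proof (induction k arbitrary: G)
  case 0
  then show ?case by (auto simp: mp_feasible_def intro: sum_nonneg)
next
  case (Suc k)
  note fsg = Suc.prems(1) and bip = Suc.prems(2) and deg = Suc.prems(3)
  have finE: "finite (edges G)" using fsg by (rule finite_edges)
  obtain M where M: "M \<in> perfect_matchings G"
    using regular_bipartite_perfect_matching[OF fsg bip deg] by auto
  then have ME: "M \<subseteq> edges G" by (simp add: perfect_matchings_def matching_def)
  define G' where "G' = G\<lparr>edges := edges G - M\<rparr>"
  have [simp]: "verts G' = verts G" "edges G' = edges G - M" by (simp_all add: G'_def)
  have "real k \<le> sum y (edges G')"
  proof (rule Suc.IH)
    show "finite_simple_graph G'" using fsg by (auto simp: finite_simple_graph_def)
    obtain A B where "A \<union> B = verts G" "A \<inter> B = {}" "\<forall>e\<in>edges G. \<exists>a\<in>A. \<exists>b\<in>B. e = {a, b}"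
      using bip unfolding bipartite_def by metis
    then show "bipartite G'"
      unfolding bipartite_def by (intro exI[of _ A] exI[of _ B]) simp
    \<comment> \<open>Deleting edges creates no new perfect matchings, so \<open>y\<close> faces no
      new constraints.\<close>
    have "perfect_matchings G' \<subseteq> perfect_matchings G"
      by (auto simp: perfect_matchings_def matching_def)
    then show "mp_feasible G' y"
      using Suc.prems(4) finE by (simp add: mp_feasible_iff subset_iff)
    fix v assume v: "v \<in> verts G'"
    then obtain e where e: "e \<in> M" "v \<in> e" using M by (auto simp: perfect_matchings_def)
    then have "e \<in> {e \<in> edges G. v \<in> e}" using ME by blast
    \<comment> \<open>Distinct edges of \<open>M\<close> are disjoint, so \<open>e\<close> is the
      only edge lost at \<open>v\<close>.\<close>
    moreover have "{e \<in> edges G'. v \<in> e} = {e \<in> edges G. v \<in> e} - {e}"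
      using M e by (auto simp: perfect_matchings_def matching_def)
    ultimately have "degree G' v = degree G v - 1"
      unfolding degree_def by (simp only: card_Diff_singleton)
    then show "degree G' v = k" using deg v by simp
  qed
  moreover have "1 \<le> sum y M" using Suc.prems(4) finE M by (auto simp: mp_feasible_iff)
  moreover have "sum y (edges G) = sum y (edges G') + sum y M"
    using sum.subset_diff[OF ME finE] by simp
  ultimately show ?case by simp
qed

lemma mp_f_regular_bipartite:
  assumes "finite_simple_graph G" and "verts G \<noteq> {}" and "bipartite G"
    and "\<And>v. v \<in> verts G \<Longrightarrow> degree G v = k"
  shows "mp_f G = k"
proof (rule antisym)
  have finE: "finite (edges G)" using assms(1) by (rule finite_edges)
  obtain v where "v \<in> verts G" using assms(2) by blast
  then show "mp_f G \<le> k" using mp_f_le_degree[OF finE] assms(4) by metis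
  show "k \<le> mp_f G"
    using assms by (intro mp_f_greatest finE regular_bipartite_sum_ge) auto
qed

section \<open>Cartesian products\<close>

lemma verts_cartesian_product [simp]: "verts (G \<box> H) = verts G \<times> verts H"
  by (simp add: cartesian_product_def)

text \<open>Writing edges as set products \<open>e \<times> {h}\<close> and
  \<open>{g} \<times> e\<close> lets sums and matchings be reindexed by pairs of an edge and a
  vertex.\<close>

lemma edges_cartesian_product:
  assumes G: "finite_simple_graph G" and H: "finite_simple_graph H"
  shows "edges (G \<box> H) = (\<lambda>(e, h). e \<times> {h}) ` (edges G \<times> verts H) \<union>
    (\<lambda>(g, e). {g} \<times> e) ` (verts G \<times> edges H)" (is "?L = ?R")
proof
  show "?L \<subseteq> ?R"
  proof
    fix x assume "x \<in> ?L"
    then obtain g h g' h' where x: "x = {(g, h), (g', h')}" "g \<in> verts G" "h \<in> verts H"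
      and "g = g' \<and> {h, h'} \<in> edges H \<or> {g, g'} \<in> edges G \<and> h = h'"
      by (auto simp: cartesian_product_def)
    then consider "x = {g} \<times> {h, h'}" "{h, h'} \<in> edges H" | "x = {g, g'} \<times> {h}" "{g, g'} \<in> edges G"
      by blast
    then show "x \<in> ?R"
    proof cases
      case 1
      then have "x = (\<lambda>(g, e). {g} \<times> e) (g, {h, h'})" by simp
      then show ?thesis using 1(2) x(2) by blast
    next
      case 2
      then have "x = (\<lambda>(e, h). e \<times> {h}) ({g, g'}, h)" by simp
      then show ?thesis using 2(2) x(3) by blast
    qed
  qed
  show "?R \<subseteq> ?L"
  proof
    fix x assume "x \<in> ?R"
    then consider (G) e h where "x = e \<times> {h}" "e \<in> edges G" "h \<in> verts H"
      | (H) g e where "x = {g} \<times> e" "g \<in> verts G" "e \<in> edges H" by auto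
    then show "x \<in> ?L"
    proof cases
      case G
      with assms(1) obtain u v where "u \<in> verts G" "v \<in> verts G" "e = {u, v}"
        by (auto simp: finite_simple_graph_def)
      moreover from this have "x = {(u, h), (v, h)}" using G by auto
      ultimately show ?thesis using G by (auto simp: cartesian_product_def)
    next
      case H
      with assms(2) obtain u v where "u \<in> verts H" "v \<in> verts H" "e = {u, v}"
        by (auto simp: finite_simple_graph_def)
      moreover from this have "x = {(g, u), (g, v)}" using H by auto
      ultimately show ?thesis using H by (auto simp: cartesian_product_def)
    qed
  qed
qed

text \<open>Nonemptiness lets a set product determine its factors; having two ends keeps the two
  kinds of product edges apart, since \<open>e \<times> {h} = {g} \<times> e'\<close> would force
  \<open>e = {g}\<close>.\<close>

lemma edge_not_subset_singleton:
  "\<lbrakk>finite_simple_graph G; e \<in> edges G\<rbrakk> \<Longrightarrow> e \<noteq> {} \<and> e \<noteq> {v}"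
  by (auto simp: finite_simple_graph_def)

lemma inj_on_edge_times_vertex:
  assumes "finite_simple_graph G"
  shows "inj_on (\<lambda>(e, h). e \<times> {h}) (edges G \<times> V)"
  using edge_not_subset_singleton[OF assms] by (auto simp: inj_on_def times_eq_iff)

lemma inj_on_vertex_times_edge:
  assumes "finite_simple_graph H"
  shows "inj_on (\<lambda>(g, e). {g} \<times> e) (V \<times> edges H)"
  using edge_not_subset_singleton[OF assms] by (auto simp: inj_on_def times_eq_iff)

lemma edges_cartesian_product_disjoint:
  assumes "finite_simple_graph G" and "finite_simple_graph H"
  shows "(\<lambda>(e, h). e \<times> {h}) ` (edges G \<times> verts H) \<inter>
    (\<lambda>(g, e). {g} \<times> e) ` (verts G \<times> edges H) = {}"
  using edge_not_subset_singleton[OF assms(1)] edge_not_subset_singleton[OF assms(2)]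
  by (auto simp: times_eq_iff)

lemma finite_edges_cartesian_product:
  assumes "finite_simple_graph G" and "finite_simple_graph H"
  shows "finite (edges (G \<box> H))"
  using assms finite_edges[OF assms(1)] finite_edges[OF assms(2)]
  by (simp add: edges_cartesian_product finite_simple_graph_def)

lemma sum_edges_cartesian_product:
  fixes y :: "('a \<times> 'b) set \<Rightarrow> real"
  assumes "finite_simple_graph G" and "finite_simple_graph H"
  shows "sum y (edges (G \<box> H)) =
    (\<Sum>e\<in>edges G. \<Sum>h\<in>verts H. y (e \<times> {h})) + (\<Sum>e\<in>edges H. \<Sum>g\<in>verts G. y ({g} \<times> e))"
proof -
  have fin: "finite (edges G)" "finite (edges H)" "finite (verts G)" "finite (verts H)"
    using assms by (auto simp: finite_edges finite_simple_graph_def)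
  have "sum y (edges (G \<box> H)) = sum y ((\<lambda>(e, h). e \<times> {h}) ` (edges G \<times> verts H)) +
      sum y ((\<lambda>(g, e). {g} \<times> e) ` (verts G \<times> edges H))"
    unfolding edges_cartesian_product[OF assms]
    using fin by (intro sum.union_disjoint edges_cartesian_product_disjoint[OF assms]) auto
  also have "sum y ((\<lambda>(e, h). e \<times> {h}) ` (edges G \<times> verts H)) =
      (\<Sum>e\<in>edges G. \<Sum>h\<in>verts H. y (e \<times> {h}))"
    unfolding sum.reindex[OF inj_on_edge_times_vertex[OF assms(1)]]
    by (simp add: sum.cartesian_product case_prod_unfold)
  also have "sum y ((\<lambda>(g, e). {g} \<times> e) ` (verts G \<times> edges H)) =
      (\<Sum>e\<in>edges H. \<Sum>g\<in>verts G. y ({g} \<times> e))"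
    unfolding sum.reindex[OF inj_on_vertex_times_edge[OF assms(2)]]
    \<comment> \<open>The edge sum stands outside in the claim, to match the fibre-sum vector on
      \<open>H\<close>; the swap restores the order of the pairs in the index set.\<close>
    by (subst sum.swap) (simp add: sum.cartesian_product case_prod_unfold)
  finally show ?thesis .
qed

lemma degree_cartesian_product:
  assumes G: "finite_simple_graph G" and H: "finite_simple_graph H"
    and g: "g \<in> verts G" and h: "h \<in> verts H"
  shows "degree (G \<box> H) (g, h) = degree G g + degree H h"
proof -
  let ?EG = "(\<lambda>e. e \<times> {h}) ` {e \<in> edges G. g \<in> e}"
  let ?EH = "(\<lambda>e. {g} \<times> e) ` {e \<in> edges H. h \<in> e}"
  have "{e \<in> edges (G \<box> H). (g, h) \<in> e} = ?EG \<union> ?EH"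
    using g h by (auto simp: edges_cartesian_product[OF G H])
  moreover have "?EG \<inter> ?EH = {}"
    using edges_cartesian_product_disjoint[OF G H] g h by fastforce
  moreover have "inj_on (\<lambda>e. e \<times> {h}) {e \<in> edges G. g \<in> e}" "inj_on (\<lambda>e. {g} \<times> e) {e \<in> edges H. h \<in> e}"
    by (auto simp: inj_on_def times_eq_iff)
  ultimately show ?thesis
    using finite_edges[OF G] finite_edges[OF H]
    by (simp add: degree_def card_Un_disjoint card_image)
qed

text \<open>Copies in one fibre are disjoint because \<open>M\<close> is a matching, copies in
  different fibres because their second coordinates differ; each fibre is covered by its own copy of
  \<open>M\<close>.\<close>

lemma perfect_matching_times_verts:
  assumes G: "finite_simple_graph G" and H: "finite_simple_graph H"
    and M: "M \<in> perfect_matchings G"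
  shows "(\<lambda>(e, h). e \<times> {h}) ` (M \<times> verts H) \<in> perfect_matchings (G \<box> H)" (is "?M \<in> _")
proof -
  have M': "M \<subseteq> edges G" "\<Union>M = verts G" "\<And>e f. e \<in> M \<Longrightarrow> f \<in> M \<Longrightarrow> e \<noteq> f \<Longrightarrow> e \<inter> f = {}"
    using M by (auto simp: perfect_matchings_def matching_def)
  have "?M \<subseteq> edges (G \<box> H)" using M'(1) by (auto simp: edges_cartesian_product[OF G H])
  moreover have "e \<inter> f = {}" if "e \<in> ?M" "f \<in> ?M" "e \<noteq> f" for e f
    using that M'(3) by fastforce
  moreover have "\<Union>?M = verts (G \<box> H)" unfolding verts_cartesian_product M'(2)[symmetric] by auto
  ultimately show ?thesis by (auto simp: perfect_matchings_def matching_def)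
qed

lemma perfect_matching_verts_times:
  assumes G: "finite_simple_graph G" and H: "finite_simple_graph H"
    and M: "M \<in> perfect_matchings H"
  shows "(\<lambda>(g, e). {g} \<times> e) ` (verts G \<times> M) \<in> perfect_matchings (G \<box> H)" (is "?M \<in> _")
proof -
  have M': "M \<subseteq> edges H" "\<Union>M = verts H" "\<And>e f. e \<in> M \<Longrightarrow> f \<in> M \<Longrightarrow> e \<noteq> f \<Longrightarrow> e \<inter> f = {}"
    using M by (auto simp: perfect_matchings_def matching_def)
  have "?M \<subseteq> edges (G \<box> H)" using M'(1) by (auto simp: edges_cartesian_product[OF G H])
  moreover have "e \<inter> f = {}" if "e \<in> ?M" "f \<in> ?M" "e \<noteq> f" for e f
    using that M'(3) by fastforce
  moreover have "\<Union>?M = verts (G \<box> H)" unfolding verts_cartesian_product M'(2)[symmetric] by auto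
  ultimately show ?thesis by (auto simp: perfect_matchings_def matching_def)
qed

text \<open>The weight of \<open>M\<close> under the fibre sums is the weight under \<open>y\<close>
  of the lifted perfect matching, hence at least 1.\<close>

lemma mp_feasible_fibre_sum_left:
  assumes G: "finite_simple_graph G" and H: "finite_simple_graph H"
    and y: "mp_feasible (G \<box> H) y"
  shows "mp_feasible G (\<lambda>e. \<Sum>h\<in>verts H. y (e \<times> {h}))"
proof -
  note y' = y[unfolded mp_feasible_iff[OF finite_edges_cartesian_product[OF G H]]]
  have "1 \<le> (\<Sum>e\<in>M. \<Sum>h\<in>verts H. y (e \<times> {h}))" if M: "M \<in> perfect_matchings G" for M
  proof -
    have "M \<subseteq> edges G" using M by (simp add: perfect_matchings_def matching_def)
    then have inj: "inj_on (\<lambda>(e, h). e \<times> {h}) (M \<times> verts H)"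
      by (intro inj_on_subset[OF inj_on_edge_times_vertex[OF G]]) auto
    have "1 \<le> sum y ((\<lambda>(e, h). e \<times> {h}) ` (M \<times> verts H))"
      using y' perfect_matching_times_verts[OF G H M] by blast
    then show ?thesis
      unfolding sum.reindex[OF inj] by (simp add: sum.cartesian_product case_prod_unfold)
  qed
  moreover have "0 \<le> (\<Sum>h\<in>verts H. y (e \<times> {h}))" if "e \<in> edges G" for e
    using that y' by (auto simp: edges_cartesian_product[OF G H] intro!: sum_nonneg)
  ultimately show ?thesis by (simp add: mp_feasible_iff[OF finite_edges[OF G]])
qed

lemma mp_feasible_fibre_sum_right:
  assumes G: "finite_simple_graph G" and H: "finite_simple_graph H"
    and y: "mp_feasible (G \<box> H) y"
  shows "mp_feasible H (\<lambda>e. \<Sum>g\<in>verts G. y ({g} \<times> e))"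
proof -
  note y' = y[unfolded mp_feasible_iff[OF finite_edges_cartesian_product[OF G H]]]
  have "1 \<le> (\<Sum>e\<in>M. \<Sum>g\<in>verts G. y ({g} \<times> e))" if M: "M \<in> perfect_matchings H" for M
  proof -
    have "M \<subseteq> edges H" using M by (simp add: perfect_matchings_def matching_def)
    then have inj: "inj_on (\<lambda>(g, e). {g} \<times> e) (verts G \<times> M)"
      by (intro inj_on_subset[OF inj_on_vertex_times_edge[OF H]]) auto
    have "1 \<le> sum y ((\<lambda>(g, e). {g} \<times> e) ` (verts G \<times> M))"
      using y' perfect_matching_verts_times[OF G H M] by blast
    then show ?thesis
      unfolding sum.reindex[OF inj]
      by (subst sum.swap) (simp add: sum.cartesian_product case_prod_unfold)
  qed
  moreover have "0 \<le> (\<Sum>g\<in>verts G. y ({g} \<times> e))" if "e \<in> edges H" for e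
    using that y' by (auto simp: edges_cartesian_product[OF G H] intro!: sum_nonneg)
  ultimately show ?thesis by (simp add: mp_feasible_iff[OF finite_edges[OF H]])
qed

text \<open>The objective value of \<open>y\<close> is exactly the sum of the objective values of
  its two fibre-sum vectors, each bounded below by the optimum of its factor.\<close>

lemma mp_f_cartesian_product_ge:
  assumes G: "finite_simple_graph G" "verts G \<noteq> {}" and H: "finite_simple_graph H" "verts H \<noteq> {}"
  shows "mp_f G + mp_f H \<le> mp_f (G \<box> H)"
proof (rule mp_f_greatest)
  show "finite (edges (G \<box> H))" by (rule finite_edges_cartesian_product[OF G(1) H(1)])
  show "verts (G \<box> H) \<noteq> {}" using G(2) H(2) by simp
  fix y assume y: "mp_feasible (G \<box> H) y"
  show "mp_f G + mp_f H \<le> sum y (edges (G \<box> H))"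
    unfolding sum_edges_cartesian_product[OF G(1) H(1)]
    by (intro add_mono mp_f_le_sum mp_feasible_fibre_sum_left[OF G(1) H(1) y]
        mp_feasible_fibre_sum_right[OF G(1) H(1) y])
qed

theorem theorem4p6:
  fixes G :: "'a ugraph" and H :: "'b ugraph"
  assumes "finite_simple_graph G" and "verts G \<noteq> {}" and "bipartite G"
    and "finite_simple_graph H" and "verts H \<noteq> {}" and "bipartite H"
  shows "mp_f (G \<box> H) \<ge> mp_f G + of_int \<lfloor>mp_f H\<rfloor> \<and>
    (regular G \<and> regular H \<longrightarrow> mp_f (G \<box> H) = mp_f G + of_int \<lfloor>mp_f H\<rfloor>)"
proof (intro conjI impI)
  show ge: "mp_f (G \<box> H) \<ge> mp_f G + of_int \<lfloor>mp_f H\<rfloor>"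
    using mp_f_cartesian_product_ge[OF assms(1,2,4,5)] of_int_floor_le[of "mp_f H"] by linarith
  assume "regular G \<and> regular H"
  then obtain k l where k: "\<And>v. v \<in> verts G \<Longrightarrow> degree G v = k"
    and l: "\<And>v. v \<in> verts H \<Longrightarrow> degree H v = l" by (auto simp: regular_def)
  have eq: "mp_f G = k" "mp_f H = l"
    using mp_f_regular_bipartite assms k l by blast+
  obtain g h where gh: "g \<in> verts G" "h \<in> verts H" using assms(2,5) by blast
  then have "mp_f (G \<box> H) \<le> degree (G \<box> H) (g, h)"
    by (intro mp_f_le_degree finite_edges_cartesian_product assms) auto
  then have "mp_f (G \<box> H) \<le> k + l"
    using gh by (simp add: degree_cartesian_product[OF assms(1,4)] k l)
  \<comment> \<open>As \<open>mp_f H\<close> is the natural number \<open>l\<close>, the floor loses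
    nothing and \<open>ge\<close> provides the matching lower bound \<open>k + l\<close>.\<close>
  then show "mp_f (G \<box> H) = mp_f G + of_int \<lfloor>mp_f H\<rfloor>" using ge eq by simp
qed

end
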